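(* Let $\mathbf{g}_1, \mathbf{g}_2\in\mathbb{N}_0^d$ with $\mathbf{g}_1\le\mathbf{g}_2$ and $\mathbf{g}_2\neq\mathbf{0}$. Every element of $\mathcal{M}\mathcal{F}(\mathbf{g}_2 + \mathbf{1};\mathbf{g}_1, \mathbf{g}_2)$ is non-irreducible if and only if $\mathbf{g}_2$ is a multiple of $\mathbf{g}_2-\mathbf{g}_1$ and $2\mathbf{g}_1\neq \mathbf{g}_2$.
   Context: $\mathbb{N}_0$ is the set of non-negative integers and $d\ge 1$ is an integer. A generalized numerical semigroup (GNS) in $\mathbb{N}_0^d$ is a subset $S\subseteq\mathbb{N}_0^d$ closed under addition, containing $\mathbf{0}$, with finite complement $\operatorname{H}(S)=\mathbb{N}_0^d\setminus S$ (the gaps of $S$). On $\mathbb{N}_0^d$, $\leq$ is the componentwise partial order; $\mathbf{1}=(1,\dots,1)$. A multiple of $\mathbf{x}$ is an element $k\mathbf{x}$ with $k$ a positive integer. Corner element: the corner element of a GNS $S$ is the unique $\mathbf{c}=(c_1,\dots,c_d)\in S$ such that (1) for all $i$ and all $x\in\mathbb{N}_0$ with $x\ge c_i$, every vector of $\mathbb{N}_0^d$ with $i$-th coordinate $x$ lies in $S$; (2) for all $i$, there are $z_j\in\mathbb{N}_0$ ($j\neq i$) such that $(z_1,\dots,z_{i-1},c_i-1,z_{i+1},\dots,z_d)\notin S$. (If $\operatorname{H}(S)\ne\emptyset$, then $c_i=1+\max\{h_i:\mathbf{h}\in \operatorname{H}(S)\}$ for each $i$.) For $\mathbf{h}_1,\dots,\mathbf{h}_n\le\mathbf{c}-\mathbf{1}$,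 $\mathcal{F}(\mathbf{c};\mathbf{h}_1,\dots,\mathbf{h}_n)$ is the set of GNSs $S\subseteq\mathbb{N}_0^d$ with corner element $\mathbf{c}$ and $S\cap\{\mathbf{h}_1,\dots,\mathbf{h}_n\}=\emptyset$, and $\mathcal{M}\mathcal{F}(\mathbf{c};\mathbf{h}_1,\dots,\mathbf{h}_n)$ is the set of its elements maximal with respect to inclusion. A GNS $S$ is irreducible if it cannot be expressed as an intersection of two GNSs properly containing $S$, and non-irreducible otherwise. *)

theory Defs
  imports "HOL-Analysis.Analysis"
begin

text \<open>Elements of \<open>\<nat>\<^sub>0\<^sup>d\<close> are vectors of type \<^typ>\<open>nat ^ 'd\<close> with \<open>d = CARD('d) \<ge> 1\<close>;
  the library order on them is the componentwise one, and \<open>1\<close> is the all-ones vector.\<close>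

definition gaps :: "(nat ^ 'd) set \<Rightarrow> (nat ^ 'd) set" where
  "gaps S = UNIV - S"

definition gns :: "(nat ^ 'd) set \<Rightarrow> bool" where
  "gns S \<longleftrightarrow> 0 \<in> S \<and> (\<forall>x\<in>S. \<forall>y\<in>S. x + y \<in> S) \<and> finite (gaps S)"

text \<open>In the second condition, a coordinate \<open>c $ i = 0\<close> is unconstrained: there \<open>c\<^sub>i - 1 = -1\<close>,
  and no vector with that coordinate lies in \<open>S\<close>. By the first condition this happens only for
  \<open>S = \<nat>\<^sub>0\<^sup>d\<close>, whose corner element is therefore \<open>0\<close>.\<close>

definition is_corner :: "nat ^ 'd \<Rightarrow> (nat ^ 'd) set \<Rightarrow> bool" where
  "is_corner c S \<longleftrightarrow> c \<in> S \<and>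
     (\<forall>i y. c $ i \<le> y $ i \<longrightarrow> y \<in> S) \<and>
     (\<forall>i. c $ i = 0 \<or> (\<exists>y. y $ i = c $ i - 1 \<and> y \<notin> S))"

lemma ex1_corner:
  fixes S :: "(nat ^ 'd) set"
  assumes "gns S"
  shows "\<exists>!c. is_corner c S"
proof (rule ex_ex1I)
  define P where "P i n \<longleftrightarrow> (\<forall>y. n \<le> y $ i \<longrightarrow> y \<in> S)" for i n
  define c :: "nat ^ 'd" where "c = (\<chi> i. LEAST n. P i n)"
  have "\<exists>n. P i n" for i
  proof -
    have fin: "finite ((\<lambda>y. y $ i) ` gaps S)"
      using assms by (simp add: gns_def)
    have "P i (Suc (Max ((\<lambda>y. y $ i) ` gaps S)))"
      unfolding P_def
    proof (intro allI impI)
      fix y :: "nat ^ 'd"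
      assume "Suc (Max ((\<lambda>y. y $ i) ` gaps S)) \<le> y $ i"
      then have "y \<notin> gaps S"
        using Max_ge[OF fin, of "y $ i"] by fastforce
      then show "y \<in> S" by (simp add: gaps_def)
    qed
    then show ?thesis ..
  qed
  then have P: "P i (c $ i)" for i
    unfolding c_def by (auto intro: LeastI_ex)
  have "\<exists>y. y $ i = c $ i - 1 \<and> y \<notin> S" if "c $ i \<noteq> 0" for i
  proof -
    have "\<not> P i (c $ i - 1)"
      using that not_less_Least[of "c $ i - 1" "P i"] by (simp add: c_def)
    then obtain y where "c $ i - 1 \<le> y $ i" "y \<notin> S" by (auto simp: P_def)
    moreover from this P[of i] have "\<not> c $ i \<le> y $ i" by (auto simp: P_def)
    ultimately have "y $ i = c $ i - 1" by linarith
    with \<open>y \<notin> S\<close> show ?thesis by blast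
  qed
  then show "\<exists>c. is_corner c S"
    using P unfolding is_corner_def P_def by blast
next
  fix a b assume ab: "is_corner a S" "is_corner b S"
  have "b' $ i \<le> a' $ i" if a': "is_corner a' S" and b': "is_corner b' S" for a' b' i
  proof (rule ccontr)
    assume less: "\<not> b' $ i \<le> a' $ i"
    then obtain y where y: "y $ i = b' $ i - 1" "y \<notin> S"
      using b' unfolding is_corner_def by (metis zero_le)
    with less have "a' $ i \<le> y $ i" by linarith
    with a' y(2) show False by (auto simp: is_corner_def)
  qed
  with ab show "a = b" by (simp add: vec_eq_iff order_antisym)
qed

text \<open>\<open>gns_family c A\<close> is \<open>\<F>(c; h\<^sub>1, \<dots>, h\<^sub>n)\<close> for \<open>A = {h\<^sub>1, \<dots>, h\<^sub>n}\<close>.\<close>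

definition gns_family :: "nat ^ 'd \<Rightarrow> (nat ^ 'd) set \<Rightarrow> (nat ^ 'd) set set" where
  "gns_family c A = {S. gns S \<and> is_corner c S \<and> S \<inter> A = {}}"

definition max_gns_family :: "nat ^ 'd \<Rightarrow> (nat ^ 'd) set \<Rightarrow> (nat ^ 'd) set set" where
  "max_gns_family c A = {S \<in> gns_family c A. \<not> (\<exists>T \<in> gns_family c A. S \<subset> T)}"

definition irreducible_gns :: "(nat ^ 'd) set \<Rightarrow> bool" where
  "irreducible_gns S \<longleftrightarrow> gns S \<and>
     \<not> (\<exists>T1 T2. gns T1 \<and> gns T2 \<and> S \<subset> T1 \<and> S \<subset> T2 \<and> S = T1 \<inter> T2)"

definition is_multiple_of :: "nat ^ 'd \<Rightarrow> nat ^ 'd \<Rightarrow> bool" where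
  "is_multiple_of y x \<longleftrightarrow> (\<exists>k::nat. k > 0 \<and> y = k *s x)"

end

theory Submission
  imports Defs
begin

text \<open>A semigroup in the family has all its gaps below \<open>g2\<close>, so \<open>g2\<close> can always be adjoined to it.
  Hence it is irreducible iff it is maximal among the semigroups omitting \<open>g2\<close>, and then it
  contains \<open>x\<close> or \<open>g2 - x\<close> for every \<open>x \<le> g2\<close> with \<open>2x \<noteq> g2\<close>. So an irreducible member omitting
  \<open>g1\<close> contains every multiple of \<open>g2 - g1\<close> as soon as \<open>2 g1 \<noteq> g2\<close>, which is impossible if \<open>g2\<close> is one
  of these. Otherwise, an irreducible member is obtained by enlarging the semigroup formed by the
  vectors \<open>\<not> \<le> g2\<close> and the multiples of \<open>g2 - g1\<close> (only of \<open>0\<close>, if \<open>2 g1 = g2\<close>).\<close>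

text \<open>Since \<open>g\<close> itself is a gap, it witnesses the second corner condition in
  every coordinate at once. The first condition, read contrapositively, bounds every gap by
  \<open>g\<close>.\<close>

lemma gns_family_iff:
  fixes g :: "nat ^ 'd"
  assumes "g \<in> A"
  shows "S \<in> gns_family (g + 1) A \<longleftrightarrow> gns S \<and> (\<forall>x. x \<notin> S \<longrightarrow> x \<le> g) \<and> S \<inter> A = {}"
proof -
  have "is_corner (g + 1) S \<longleftrightarrow> (\<forall>x. x \<notin> S \<longrightarrow> x \<le> g)" if "g \<notin> S"
  proof
    assume "is_corner (g + 1) S"
    then show "\<forall>x. x \<notin> S \<longrightarrow> x \<le> g"
      by (force simp: is_corner_def less_eq_vec_def not_less_eq_eq)
  next
    assume le: "\<forall>x. x \<notin> S \<longrightarrow> x \<le> g"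
    have above: "y \<in> S" if "(g + 1) $ i \<le> y $ i" for i y
    proof (rule ccontr)
      assume "y \<notin> S"
      with le have "y $ i \<le> g $ i" by (simp add: less_eq_vec_def)
      with that show False by simp
    qed
    moreover have "g + 1 \<in> S"
      using above by blast
    ultimately show "is_corner (g + 1) S"
      using \<open>g \<notin> S\<close> by (auto simp: is_corner_def)
  qed
  with assms show ?thesis
    by (auto simp: gns_family_def)
qed

lemma gns_insertI:
  fixes S :: "(nat ^ 'd) set"
  assumes "gns S" "h + h \<in> S" "\<And>s. s \<in> S \<Longrightarrow> s \<noteq> 0 \<Longrightarrow> h + s \<in> S"
  shows "gns (insert h S)"
proof -
  have "finite (gaps (insert h S))"
    using assms(1) by (auto simp: gns_def gaps_def intro: finite_subset[rotated])
  moreover have "h + s \<in> insert h S" "s + h \<in> insert h S" if "s \<in> S" for s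
    using that assms(3)[of s] by (cases "s = 0"; simp add: add.commute)+
  ultimately show ?thesis
    using assms(1,2) by (auto simp: gns_def)
qed

text \<open>Adding a nonzero vector to \<open>g\<close> leaves the box below \<open>g\<close>, which
  contains all gaps.\<close>

lemma gns_insert_top_gap:
  fixes S :: "(nat ^ 'd) set"
  assumes "gns S" "\<And>x. x \<notin> S \<Longrightarrow> x \<le> g" "g \<notin> S"
  shows "gns (insert g S)"
proof -
  have "g + s \<in> S" if "s \<noteq> 0" for s
  proof (rule ccontr)
    assume "g + s \<notin> S"
    then have "s = 0"
      using assms(2)[of "g + s"] by (simp add: less_eq_vec_def vec_eq_iff)
    with that show False ..
  qed
  moreover have "g \<noteq> 0"
    using assms(1,3) by (auto simp: gns_def)
  ultimately show ?thesis
    using assms(1) by (intro gns_insertI) auto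
qed

lemma gns_mult_mem:
  fixes S :: "(nat ^ 'd) set"
  assumes "gns S" "x \<in> S"
  shows "k *s x \<in> S"
proof (induction k)
  case 0
  then show ?case using assms(1) by (simp add: gns_def)
next
  case (Suc k)
  have "Suc k *s x = x + k *s x" by (simp add: vec_eq_iff)
  with Suc assms show ?case by (simp add: gns_def)
qed

text \<open>Otherwise a counterexample \<open>h\<close> of largest coordinate sum could be adjoined
  to \<open>S\<close>. As \<open>g\<close> can be adjoined too, \<open>S\<close> would be the
  intersection of \<open>insert h S\<close> and \<open>insert g S\<close>.\<close>

lemma irreducible_gns_complement:
  fixes S :: "(nat ^ 'd) set"
  assumes irr: "irreducible_gns S" and le: "\<And>x. x \<notin> S \<Longrightarrow> x \<le> g" and "g \<notin> S"
    and "x \<notin> S" "2 *s x \<noteq> g"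
  shows "g - x \<in> S"
proof (rule ccontr)
  assume "g - x \<notin> S"
  have "gns S" using irr by (simp add: irreducible_gns_def)
  then have "0 \<in> S" and add: "\<And>x y. x \<in> S \<Longrightarrow> y \<in> S \<Longrightarrow> x + y \<in> S" and "finite (gaps S)"
    by (auto simp: gns_def)
  define size where "size v = (\<Sum>i\<in>UNIV. v $ i)" for v :: "nat ^ 'd"
  have size_add: "size (u + v) = size u + size v" for u v
    by (simp add: size_def sum.distrib)
  have size_0: "v = 0" if "size v = 0" for v
    using that by (simp add: size_def vec_eq_iff)
  define B where "B = {h. h \<notin> S \<and> g - h \<notin> S \<and> 2 *s h \<noteq> g}"
  have "x \<in> B" using assms \<open>g - x \<notin> S\<close> by (simp add: B_def)
  have "finite B"
    using \<open>finite (gaps S)\<close> by (rule rev_finite_subset) (auto simp: B_def gaps_def)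
  obtain h where "h \<in> B" and max: "\<And>y. y \<in> B \<Longrightarrow> size y \<le> size h"
    using obtains_MAX[OF \<open>finite B\<close>, of size] \<open>x \<in> B\<close> \<open>finite B\<close>
    by (metis Max_ge empty_iff finite_imageI imageI)
  then have h: "h \<notin> S" "g - h \<notin> S" "2 *s h \<noteq> g" by (auto simp: B_def)
  have "h \<le> g" by (rule le) fact
  then have g_eq: "g = h + (g - h)"
    by (simp add: less_eq_vec_def vec_eq_iff)
  \<comment> \<open>The set \<open>B\<close> is stable under the reflection of \<open>h\<close> to
    \<open>g - h\<close>, so a largest element has at least half the size of
    \<open>g\<close>.\<close>
  have half: "size g \<le> 2 * size h"
  proof -
    have "g - (g - h) = h"
      using \<open>h \<le> g\<close> by (simp add: less_eq_vec_def vec_eq_iff)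
    moreover have "2 *s (g - h) \<noteq> g"
    proof
      assume *: "2 *s (g - h) = g"
      have "2 *s h = g"
        unfolding vec_eq_iff
      proof
        fix i
        have "2 * (g $ i - h $ i) = g $ i" using * by (simp add: vec_eq_iff)
        moreover have "h $ i \<le> g $ i" using \<open>h \<le> g\<close> by (simp add: less_eq_vec_def)
        ultimately show "(2 *s h) $ i = g $ i" by simp
      qed
      with h show False by simp
    qed
    ultimately have "g - h \<in> B" using h by (simp add: B_def)
    from max[OF this] show ?thesis
      using size_add[of h "g - h"] g_eq by simp
  qed
  have "gns (insert h S)"
  proof (rule gns_insertI)
    \<comment> \<open>As a gap, \<open>h + h\<close> would be below \<open>g\<close> and, by
      \<open>half\<close>, equal to it.\<close>
    show "h + h \<in> S"
    proof (rule ccontr)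
      assume "h + h \<notin> S"
      then have "h + h \<le> g" by (rule le)
      then have *: "g = (h + h) + (g - (h + h))"
        by (simp add: less_eq_vec_def vec_eq_iff)
      then have "size g = size h + size h + size (g - (h + h))"
        by (metis size_add)
      with half have "g - (h + h) = 0" by (intro size_0) simp
      with * have "g = h + h" by simp
      with h(3) show False by (simp add: vec_eq_iff)
    qed
    fix s assume s: "s \<in> S" "s \<noteq> 0"
    \<comment> \<open>Otherwise \<open>h + s\<close> would be a larger element of \<open>B\<close>:
      if \<open>g - (h + s)\<close> were in \<open>S\<close>, adding \<open>s\<close> would put
      \<open>g - h\<close> there, and twice \<open>h + s\<close> is too large to be
      \<open>g\<close>.\<close>
    show "h + s \<in> S"
    proof (rule ccontr)
      assume hs: "h + s \<notin> S"
      then have "h + s \<le> g" by (rule le)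
      then have "g - h = (g - (h + s)) + s"
        by (simp add: less_eq_vec_def vec_eq_iff)
      with add s h(2) have "g - (h + s) \<notin> S" by metis
      moreover have less: "size h < size (h + s)"
        using size_0[of s] s by (auto simp: size_add)
      moreover have "2 *s (h + s) = (h + s) + (h + s)"
        by (simp add: vec_eq_iff)
      then have "2 *s (h + s) \<noteq> g"
        using half less size_add[of "h + s" "h + s"] by auto
      ultimately show False
        using max[of "h + s"] hs by (simp add: B_def)
    qed
  qed fact
  moreover have "gns (insert g S)"
    using \<open>gns S\<close> le \<open>g \<notin> S\<close> by (rule gns_insert_top_gap)
  moreover have "h \<noteq> g" using h(2) \<open>0 \<in> S\<close> by auto
  then have "S = insert h S \<inter> insert g S" by auto
  ultimately show False
    using irr h(1) \<open>g \<notin> S\<close> unfolding irreducible_gns_def by blast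
qed

lemma finite_vec_atMost: "finite {x. x \<le> (g :: nat ^ 'd)}"
proof (rule finite_imageD)
  have "vec_nth ` {x. x \<le> g} \<subseteq> (\<Pi>\<^sub>E i\<in>UNIV. {..g $ i})"
    by (auto simp: less_eq_vec_def)
  then show "finite (vec_nth ` {x. x \<le> g})"
    by (rule finite_subset) (simp add: finite_PiE)
qed (simp add: inj_on_def vec_nth_inject)

text \<open>Vectors not below \<open>g\<close> absorb every summand, so only sums of two multiples
  of \<open>a\<close> need checking.\<close>

lemma gns_multiples_union_not_le:
  fixes a g :: "nat ^ 'd"
  shows "gns (range (\<lambda>k. k *s a) \<union> {x. \<not> x \<le> g})" (is "gns ?S")
proof -
  have "(0::nat) *s a = 0" by simp
  then have "0 \<in> ?S" by (metis UnI1 rangeI)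
  moreover have "finite (gaps ?S)"
    by (rule finite_subset[OF _ finite_vec_atMost[of g]]) (auto simp: gaps_def)
  moreover have "x + y \<in> ?S" if "x \<in> ?S" "y \<in> ?S" for x y
  proof (cases "x \<le> g \<and> y \<le> g")
    case True
    with that obtain k l where "x = k *s a" "y = l *s a" by blast
    then have "x + y = (k + l) *s a" by (simp add: vector_sadd_rdistrib)
    then show ?thesis by blast
  next
    case False
    then have "\<not> x + y \<le> g"
      by (auto simp: less_eq_vec_def) (meson add_leD1, meson add_leD2)
    then show ?thesis by blast
  qed
  ultimately show ?thesis by (simp add: gns_def)
qed

text \<open>Gap sets are finite, so a semigroup with fewest gaps among those containing
  \<open>S\<close> and omitting \<open>g\<close> is maximal among them. Any two semigroups properly
  containing it both contain \<open>g\<close>, and so does their intersection.\<close>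

lemma ex_irreducible_gns:
  fixes S :: "(nat ^ 'd) set"
  assumes "gns S" "\<And>x. x \<notin> S \<Longrightarrow> x \<le> g" "g \<notin> S"
  obtains M where "S \<subseteq> M" "irreducible_gns M" "M \<in> max_gns_family (g + 1) {g}"
proof -
  define P where "P T \<longleftrightarrow> S \<subseteq> T \<and> gns T \<and> g \<notin> T" for T
  have "P S" using assms by (simp add: P_def)
  then obtain M where "P M" and min: "\<And>T. P T \<Longrightarrow> card (gaps M) \<le> card (gaps T)"
    using ex_has_least_nat[of P S "\<lambda>T. card (gaps T)"] by blast
  have maximal: "g \<in> T" if "gns T" "M \<subset> T" for T
  proof (rule ccontr)
    assume "g \<notin> T"
    with that \<open>P M\<close> have "P T" by (auto simp: P_def)
    moreover have "gaps T \<subset> gaps M" using that by (auto simp: gaps_def)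
    then have "card (gaps T) < card (gaps M)"
      using \<open>P M\<close> by (intro psubset_card_mono) (auto simp: P_def gns_def)
    ultimately show False using min[of T] by simp
  qed
  show thesis
  proof
    show "S \<subseteq> M" using \<open>P M\<close> by (simp add: P_def)
    show "irreducible_gns M"
      using maximal \<open>P M\<close> unfolding irreducible_gns_def P_def by blast
    show "M \<in> max_gns_family (g + 1) {g}"
    proof -
      have "M \<in> gns_family (g + 1) {g}"
        using \<open>P M\<close> assms(2) by (auto simp: gns_family_iff P_def)
      moreover have "gns T \<and> g \<notin> T" if "T \<in> gns_family (g + 1) {g}" for T
        using that by (simp add: gns_family_iff)
      ultimately show ?thesis
        using maximal unfolding max_gns_family_def by blast
    qed
  qed
qed

theorem theorem5p5:
  fixes g1 g2 :: "nat ^ 'd"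
  assumes "g1 \<le> g2" and "g2 \<noteq> 0"
  shows "(\<forall>S \<in> max_gns_family (g2 + 1) {g1, g2}. \<not> irreducible_gns S) \<longleftrightarrow>
           is_multiple_of g2 (g2 - g1) \<and> 2 *s g1 \<noteq> g2"
proof
  assume R: "is_multiple_of g2 (g2 - g1) \<and> 2 *s g1 \<noteq> g2"
  show "\<forall>S \<in> max_gns_family (g2 + 1) {g1, g2}. \<not> irreducible_gns S"
  proof (intro ballI notI)
    fix S assume "S \<in> max_gns_family (g2 + 1) {g1, g2}" and irr: "irreducible_gns S"
    then have S: "gns S" "\<And>x. x \<notin> S \<Longrightarrow> x \<le> g2" "g1 \<notin> S" "g2 \<notin> S"
      by (auto simp: max_gns_family_def gns_family_iff)
    then have "g2 - g1 \<in> S"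
      using R by (intro irreducible_gns_complement[OF irr]) auto
    with \<open>gns S\<close> have "k *s (g2 - g1) \<in> S" for k
      by (rule gns_mult_mem)
    with R \<open>g2 \<notin> S\<close> show False
      by (metis is_multiple_of_def)
  qed
next
  assume L: "\<forall>S \<in> max_gns_family (g2 + 1) {g1, g2}. \<not> irreducible_gns S"
  have g2_eq: "g1 + (g2 - g1) = g2"
    using assms(1) by (simp add: less_eq_vec_def vec_eq_iff)
  show "is_multiple_of g2 (g2 - g1) \<and> 2 *s g1 \<noteq> g2"
  proof (rule ccontr)
    assume R: "\<not> ?thesis"
    \<comment> \<open>If \<open>2 *s g1 = g2\<close>, then \<open>g2 - g1\<close> is
      \<open>g1\<close> and generates \<open>g2\<close>, so only the zero vector is taken.\<close>
    define a where "a = (if 2 *s g1 = g2 then 0 else g2 - g1)"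
    have not_mult: "g2 \<noteq> k *s a" for k
    \<comment> \<open>The case \<open>k = 0\<close> is separate because
      \<open>is_multiple_of\<close> asks for a positive factor, while the range in \<open>S\<close>
      starts at zero.\<close>
    proof (cases "k = 0 \<or> a = 0")
      case True
      then have "k *s a = 0" by (auto simp: vec_eq_iff)
      with assms(2) show ?thesis by simp
    next
      case False
      then have "2 *s g1 \<noteq> g2" "a = g2 - g1" "k > 0"
        unfolding a_def by (simp_all split: if_splits)
      with R have "\<not> is_multiple_of g2 a" by simp
      show ?thesis
      proof
        assume "g2 = k *s a"
        with \<open>k > 0\<close> have "is_multiple_of g2 a"
          unfolding is_multiple_of_def by (intro exI conjI)
        with \<open>\<not> is_multiple_of g2 a\<close> show False ..
      qed
    qed
    define S where "S = range (\<lambda>k. k *s a) \<union> {x. \<not> x \<le> g2}"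
    have "gns S" unfolding S_def by (rule gns_multiples_union_not_le)
    moreover have "g2 \<notin> S" using not_mult by (auto simp: S_def)
    moreover have "x \<le> g2" if "x \<notin> S" for x using that by (simp add: S_def)
    ultimately obtain M where M: "S \<subseteq> M" "irreducible_gns M" "M \<in> max_gns_family (g2 + 1) {g2}"
      using ex_irreducible_gns[of S g2] by blast
    then have "gns M" "g2 \<notin> M"
      by (auto simp: max_gns_family_def gns_family_iff)
    then have add: "x + y \<in> M" if "x \<in> M" "y \<in> M" for x y
      using that by (simp add: gns_def)
    have "1 *s a = a" by (simp add: vec_eq_iff)
    then have "a \<in> S" unfolding S_def by (metis UnI1 rangeI)
    \<comment> \<open>Together with \<open>g1\<close>, either \<open>g1\<close> again or
      \<open>a\<close> would sum to the gap \<open>g2\<close>.\<close>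
    have "g1 \<notin> M"
    proof
      assume "g1 \<in> M"
      show False
      proof (cases "2 *s g1 = g2")
        case True
        have "g1 + g1 = 2 *s g1" by (simp add: vec_eq_iff)
        with add[OF \<open>g1 \<in> M\<close> \<open>g1 \<in> M\<close>] True \<open>g2 \<notin> M\<close> show False by simp
      next
        case False
        then have "g1 + a = g2" unfolding a_def using g2_eq by simp
        moreover have "a \<in> M" using \<open>a \<in> S\<close> \<open>S \<subseteq> M\<close> ..
        ultimately show False using add[OF \<open>g1 \<in> M\<close>] \<open>g2 \<notin> M\<close> by metis
      qed
    qed
    \<comment> \<open>Maximality passes from the family omitting \<open>g2\<close> to the subfamily
      that also omits \<open>g1\<close>, since \<open>M\<close> lies in it.\<close>
    with M(3) have "M \<in> max_gns_family (g2 + 1) {g1, g2}"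
      by (auto simp: max_gns_family_def gns_family_iff)
    with L M(2) show False by blast
  qed
qed

end
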